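(* Let $a,b$ be positive lengths (positive real numbers), and define successively $$u=\frac{a^2}{b},\qquad v=\sqrt{u^2+b^2},\qquad w=\sqrt{bv},\qquad c=\frac{ab}{w}.$$ Then the segment $c$ satisfies $$\frac1{c^4}=\frac1{a^4}+\frac1{b^4}.$$
   Context: The four quantities are lengths of segments obtained by standard straightedge-and-compass stages: $u$ is the third proportional to $b,a$ (that is, $b:a=a:u$); $v$ is the hypotenuse of a right triangle with legs $u$ and $b$; $w$ is the mean proportional between $b$ and $v$; and $c$ is the fourth proportional with $w:a=b:c$. All square roots are the nonnegative ones. *)

theory Defs
  imports Complex_Main
begin

end

theory Submission
  imports Defs
begin

text \<open>
  The auxiliary length \<open>w\<close> is built so that \<open>w ^ 4 = a ^ 4 + b ^ 4\<close>: squaring the mean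
  proportional twice gives \<open>w ^ 4 = b\<^sup>2 * v\<^sup>2 = b\<^sup>2 * u\<^sup>2 + b ^ 4\<close>, and \<open>b * u = a\<^sup>2\<close>. The fourth
  proportional \<open>c = a * b / w\<close> then turns this sum of fourth powers into a sum of their reciprocals:
  \<open>1 / c ^ 4 = w ^ 4 / (a * b) ^ 4\<close>.
\<close>

theorem proposition3:
  fixes a b u v w c :: real
  assumes "a > 0" and "b > 0"
    and "u = a\<^sup>2 / b"
    and "v = sqrt (u\<^sup>2 + b\<^sup>2)"
    and "w = sqrt (b * v)"
    and "c = a * b / w"
  shows "1 / c ^ 4 = 1 / a ^ 4 + 1 / b ^ 4"
proof -
  have bu: "b * u = a\<^sup>2"
    using assms(2,3) by simp
  have v_sq: "v\<^sup>2 = u\<^sup>2 + b\<^sup>2"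
    using assms(4) by simp
  have "v \<ge> 0"
    using assms(4) by simp
  then have w_sq: "w\<^sup>2 = b * v"
    using assms(2,5) by simp
  have "w ^ 4 = (w\<^sup>2)\<^sup>2"
    by simp
  also have "\<dots> = b\<^sup>2 * v\<^sup>2"
    by (simp add: w_sq power_mult_distrib)
  also have "\<dots> = (b * u)\<^sup>2 + (b\<^sup>2)\<^sup>2"
    unfolding v_sq by (simp add: power2_eq_square algebra_simps)
  also have "\<dots> = a ^ 4 + b ^ 4"
    by (simp add: bu)
  finally have w_fourth: "w ^ 4 = a ^ 4 + b ^ 4" .
  have "1 / c ^ 4 = w ^ 4 / (a ^ 4 * b ^ 4)"
    by (simp add: assms(6) power_divide power_mult_distrib)
  also have "\<dots> = 1 / a ^ 4 + 1 / b ^ 4"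
    using assms(1,2) by (simp add: w_fourth field_simps)
  finally show ?thesis .
qed

end
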